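(* Let $-1<\alpha\leq1$ and let $\mathfrak{g}=\mathfrak{g}_{4.8}^{\alpha}$ be the four-dimensional real Lie algebra with basis $\mathcal{B}=\{e_1,e_2,e_3,e_4\}$ whose nonzero Lie brackets (up to skew-symmetry) are $[e_1,e_4]=(1+\alpha)e_1$, $[e_2,e_4]=e_2$, $[e_3,e_4]=\alpha e_3$, $[e_2,e_3]=e_1$. Let $\langle\cdot,\cdot\rangle$ be a pseudo-Riemannian inner product on $\mathfrak{g}$ and let $(R_{ij})$ be the matrix of its Ricci operator $\operatorname{Ric}$ in the basis $\mathcal{B}$. If $$R_{i1}=0\ (i=2,3,4),\quad R_{42}=R_{43}=0,\quad R_{34}=-\alpha R_{12},\quad R_{24}=R_{13},$$ $$\alpha R_{32}=R_{32},\quad \alpha R_{23}=R_{23},\quad R_{44}=R_{22}+R_{33}-R_{11},$$ then $\langle\cdot,\cdot\rangle$ is an algebraic Ricci soliton. Under these conditions, $\operatorname{Ric}=\eta I_4+D$ where $\eta=R_{44}=R_{22}+R_{33}-R_{11}$ and $$D=\begin{bmatrix}R_{11}-R_{44}&R_{12}&R_{13}&R_{14}\\0&R_{22}-R_{44}&R_{23}&R_{13}\\0&R_{32}&R_{33}-R_{44}&-\alpha R_{12}\\0&0&0&0\end{bmatrix}$$ is (the matrix in the basis $\mathcal{B}$ of) a derivation of $\mathfrak{g}$. If $R_{23}=R_{32}=0$, the identities $\alpha R_{32}=R_{32}$ and $\alpha R_{23}=R_{23}$ impose no additional condition on $\alpha$; but if $R_{23}\neq0$ or $R_{32}\neq0$,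 then they give $\alpha=1$.
   Context: A pseudo-Riemannian inner product on a real Lie algebra $\mathfrak{g}$ is a nondegenerate symmetric bilinear form $\langle\cdot,\cdot\rangle$ on $\mathfrak{g}$ (of some signature $(r,s)$). Its Levi-Civita connection $\nabla$ is defined by $2\langle\nabla_uv,w\rangle=\langle[u,v],w\rangle+\langle[w,u],v\rangle+\langle[w,v],u\rangle$; its curvature is $R_{uv}=\nabla_{[u,v]}-[\nabla_u,\nabla_v]$; its Ricci curvature $\operatorname{ric}(u,v)$ is the trace of $w\mapsto R_{uw}v$; its Ricci operator $\operatorname{Ric}$ is the endomorphism of $\mathfrak{g}$ with $\langle\operatorname{Ric}(u),v\rangle=\operatorname{ric}(u,v)$. The matrix $(R_{ij})$ of $\operatorname{Ric}$ in a basis $\{e_i\}$ is given by $\operatorname{Ric}(e_j)=\sum_iR_{ij}e_i$ (the same column convention is used for $D$). A derivation is a linear map $D:\mathfrak{g}\to\mathfrak{g}$ with $D[x,y]=[D(x),y]+[x,D(y)]$ for all $x,y$. The inner product is an algebraic Ricci soliton if $\operatorname{Ric}=\eta\,\mathrm{Id}_{\mathfrak{g}}+D$ for some $\eta\in\mathbb{R}$ and some derivation $D$ of $\mathfrak{g}$. *)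

theory Defs
  imports "HOL-Analysis.Analysis"
begin

section \<open>Bases, matrices and traces\<close>

definition is_basis :: "('n::finite \<Rightarrow> 'a::real_vector) \<Rightarrow> bool" where
  "is_basis e \<longleftrightarrow> inj e \<and> independent (range e) \<and> span (range e) = UNIV"

text \<open>Column convention: column \<open>j\<close> holds the coordinates of \<open>f (e j)\<close>.\<close>

definition matrix_wrt :: "('n::finite \<Rightarrow> 'a::real_vector) \<Rightarrow> ('a \<Rightarrow> 'a) \<Rightarrow> real^'n^'n" where
  "matrix_wrt e f = (\<chi> i j. representation (range e) (f (e j)) (e i))"

lemma matrix_wrt_column:
  assumes "is_basis e"
  shows "f (e j) = (\<Sum>i\<in>UNIV. matrix_wrt e f $ i $ j *\<^sub>R e i)"
proof -
  have "(\<Sum>b\<in>range e. representation (range e) (f (e j)) b *\<^sub>R b) = f (e j)"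
    using assms unfolding is_basis_def
    by (intro real_vector.sum_representation_eq) auto
  then show ?thesis
    using assms unfolding is_basis_def
    by (simp add: matrix_wrt_def sum.reindex)
qed

text \<open>The trace of an endomorphism of a finite-dimensional space, read off in a chosen basis;
  the lemma \<open>endo_trace_eq\<close> shows that the choice does not matter.\<close>

definition endo_trace :: "('a::real_vector \<Rightarrow> 'a) \<Rightarrow> real" where
  "endo_trace f =
     (let B = (SOME B. independent B \<and> span B = UNIV) in \<Sum>b\<in>B. representation B (f b) b)"

lemma trace_representation_independent:
  fixes f :: "'a::real_vector \<Rightarrow> 'a"
  assumes f: "linear f"
    and B: "independent B" "span B = UNIV" "finite B"
    and C: "independent C" "span C = UNIV" "finite C"
  shows "(\<Sum>b\<in>B. representation B (f b) b) = (\<Sum>c\<in>C. representation C (f c) c)"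
proof -
  let ?b = "representation B" and ?c = "representation C"
  have expB: "v = (\<Sum>b\<in>B. ?b v b *\<^sub>R b)" for v
    using real_vector.sum_representation_eq[of B v B] B by simp
  have expC: "v = (\<Sum>c\<in>C. ?c v c *\<^sub>R c)" for v
    using real_vector.sum_representation_eq[of C v C] C by simp
  have linB: "linear (\<lambda>v. ?b v x)" for x
    using real_vector.linear_representation[OF B(1,2)] by (simp add: linear_def real_scaleR_def[abs_def])
  have linC: "linear (\<lambda>v. ?c v x)" for x
    using real_vector.linear_representation[OF C(1,2)] by (simp add: linear_def real_scaleR_def[abs_def])
  have "?b (f b) b = (\<Sum>c\<in>C. ?c b c * ?b (f c) b)" for b
  proof -
    have lin: "linear (\<lambda>v. ?b (f v) b)"
      using linear_compose[OF f linB] by (simp add: o_def)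
    then have "?b (f (\<Sum>c\<in>C. ?c b c *\<^sub>R c)) b = (\<Sum>c\<in>C. ?c b c * ?b (f c) b)"
      by (simp add: linear_sum[OF lin] linear_cmul[OF lin])
    then show ?thesis by (subst (asm) expC[symmetric])
  qed
  then have "(\<Sum>b\<in>B. ?b (f b) b) = (\<Sum>b\<in>B. \<Sum>c\<in>C. ?c b c * ?b (f c) b)"
    by simp
  also have "\<dots> = (\<Sum>c\<in>C. \<Sum>b\<in>B. ?c b c * ?b (f c) b)"
    by (rule sum.swap)
  also have "\<dots> = (\<Sum>c\<in>C. ?c (f c) c)"
  proof (rule sum.cong[OF refl])
    fix c
    have "?c (\<Sum>b\<in>B. ?b (f c) b *\<^sub>R b) c = (\<Sum>b\<in>B. ?b (f c) b * ?c b c)"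
      by (simp add: linear_sum[OF linC] linear_cmul[OF linC])
    then show "(\<Sum>b\<in>B. ?c b c * ?b (f c) b) = ?c (f c) c"
      by (subst (asm) expB[symmetric]) (simp add: mult.commute)
  qed
  finally show ?thesis .
qed

lemma endo_trace_eq:
  fixes e :: "'n::finite \<Rightarrow> 'a::real_vector"
  assumes f: "linear f" and e: "is_basis e"
  shows "endo_trace f = trace (matrix_wrt e f)"
proof -
  define B where "B = (SOME B::'a set. independent B \<and> span B = UNIV)"
  have C: "independent (range e)" "span (range e) = UNIV" "inj e"
    using e by (auto simp: is_basis_def)
  have B: "independent B \<and> span B = UNIV"
    unfolding B_def by (rule someI[of _ "range e"]) (use C in auto)
  have "finite B"
    using real_vector.independent_span_bound[of "range e" B] B C by simp
  then have "endo_trace f = (\<Sum>b\<in>range e. representation (range e) (f b) b)"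
    unfolding endo_trace_def Let_def B_def[symmetric]
    by (intro trace_representation_independent[OF f]) (use B C in simp_all)
  then show ?thesis
    using C by (simp add: trace_def matrix_wrt_def sum.reindex)
qed

section \<open>Lie algebras and derivations\<close>

definition lie_bracket :: "('a::real_vector \<Rightarrow> 'a \<Rightarrow> 'a) \<Rightarrow> bool" where
  "lie_bracket br \<longleftrightarrow> bilinear br \<and> (\<forall>x. br x x = 0) \<and>
     (\<forall>x y z. br x (br y z) + br y (br z x) + br z (br x y) = 0)"

definition lie_derivation :: "('a::real_vector \<Rightarrow> 'a \<Rightarrow> 'a) \<Rightarrow> ('a \<Rightarrow> 'a) \<Rightarrow> bool" where
  "lie_derivation br D \<longleftrightarrow> linear D \<and> (\<forall>x y. D (br x y) = br (D x) y + br x (D y))"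

text \<open>In the index type \<open>4\<close> the numeral \<open>4\<close> equals \<open>0\<close>; the four elements are \<open>1, 2, 3, 4\<close>.\<close>

definition lie_algebra_4_8 ::
    "real \<Rightarrow> ('a::real_vector \<Rightarrow> 'a \<Rightarrow> 'a) \<Rightarrow> (4 \<Rightarrow> 'a) \<Rightarrow> bool" where
  "lie_algebra_4_8 \<alpha> br e \<longleftrightarrow> lie_bracket br \<and> is_basis e \<and>
     br (e 1) (e 4) = (1 + \<alpha>) *\<^sub>R e 1 \<and>
     br (e 2) (e 4) = e 2 \<and>
     br (e 3) (e 4) = \<alpha> *\<^sub>R e 3 \<and>
     br (e 2) (e 3) = e 1 \<and>
     br (e 1) (e 2) = 0 \<and>
     br (e 1) (e 3) = 0"

lemma is_basis_axis: "is_basis (\<lambda>i::'n::finite. axis i (1::real))"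
proof -
  have r: "range (\<lambda>i::'n. axis i (1::real)) = Basis"
    by (auto simp: Basis_vec_def)
  show ?thesis unfolding is_basis_def r
    by (auto simp: independent_Basis axis_eq_axis inj_def)
qed

lemma vector_4 [simp]:
  "(vector [a,b,c,d] :: 'a::zero^4) $ 1 = a"
  "(vector [a,b,c,d] :: 'a::zero^4) $ 2 = b"
  "(vector [a,b,c,d] :: 'a::zero^4) $ 3 = c"
  "(vector [a,b,c,d] :: 'a::zero^4) $ 4 = d"
  by (simp_all add: vector_def)

text \<open>The structure constants do define a Lie algebra for every \<open>\<alpha>\<close>.\<close>

lemma lie_algebra_4_8_real4:
  "lie_algebra_4_8 \<alpha>
  (\<lambda>x y. vector [(1+\<alpha>)*(x$1*y$4-x$4*y$1) + (x$2*y$3-x$3*y$2), x$2*y$4-x$4*y$2, \<alpha>*(x$3*y$4-x$4*y$3), 0])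
  (\<lambda>i. axis i 1)"
  unfolding lie_algebra_4_8_def lie_bracket_def bilinear_def
  by (simp add: is_basis_axis)
    (auto simp: vec_eq_iff forall_4 vector_4 axis_def intro!: linearI, (simp add: algebra_simps)+)

section \<open>Pseudo-Riemannian inner products and their curvature\<close>

definition pseudo_riemannian :: "('a::real_vector \<Rightarrow> 'a \<Rightarrow> real) \<Rightarrow> bool" where
  "pseudo_riemannian g \<longleftrightarrow> bilinear g \<and> (\<forall>u v. g u v = g v u) \<and>
     (\<forall>u. (\<forall>v. g u v = 0) \<longrightarrow> u = 0)"

text \<open>On a finite-dimensional space the vectors described by \<open>levi_civita\<close> and \<open>ricci_operator\<close>
  exist and are unique because \<open>g\<close> is nondegenerate.\<close>

definition levi_civita ::
    "('a::real_vector \<Rightarrow> 'a \<Rightarrow> 'a) \<Rightarrow> ('a \<Rightarrow> 'a \<Rightarrow> real) \<Rightarrow> 'a \<Rightarrow> 'a \<Rightarrow> 'a" where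
  "levi_civita br g u v =
     (THE x. \<forall>w. 2 * g x w = g (br u v) w + g (br w u) v + g (br w v) u)"

definition curvature ::
    "('a::real_vector \<Rightarrow> 'a \<Rightarrow> 'a) \<Rightarrow> ('a \<Rightarrow> 'a \<Rightarrow> real) \<Rightarrow> 'a \<Rightarrow> 'a \<Rightarrow> 'a \<Rightarrow> 'a" where
  "curvature br g u v w =
     levi_civita br g (br u v) w -
     (levi_civita br g u (levi_civita br g v w) - levi_civita br g v (levi_civita br g u w))"

definition ricci ::
    "('a::real_vector \<Rightarrow> 'a \<Rightarrow> 'a) \<Rightarrow> ('a \<Rightarrow> 'a \<Rightarrow> real) \<Rightarrow> 'a \<Rightarrow> 'a \<Rightarrow> real" where
  "ricci br g u v = endo_trace (\<lambda>w. curvature br g u w v)"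

definition ricci_operator ::
    "('a::real_vector \<Rightarrow> 'a \<Rightarrow> 'a) \<Rightarrow> ('a \<Rightarrow> 'a \<Rightarrow> real) \<Rightarrow> 'a \<Rightarrow> 'a" where
  "ricci_operator br g u = (THE x. \<forall>v. g x v = ricci br g u v)"

definition algebraic_ricci_soliton ::
    "('a::real_vector \<Rightarrow> 'a \<Rightarrow> 'a) \<Rightarrow> ('a \<Rightarrow> 'a \<Rightarrow> real) \<Rightarrow> bool" where
  "algebraic_ricci_soliton br g \<longleftrightarrow>
     (\<exists>\<eta> D. lie_derivation br D \<and> ricci_operator br g = (\<lambda>x. \<eta> *\<^sub>R x + D x))"

end

theory Submission
  imports Defs
begin

text \<open>Nondegeneracy makes every linear form \<open>\<phi>\<close> equal to \<open>g x\<close> for a unique \<open>x\<close>, so the connection, and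
  with it the curvature and the Ricci form, are multilinear, and \<open>Ric\<close> is a linear map, determined by
  its matrix. Then \<open>D = Ric - \<eta> Id\<close> is linear, and the Leibniz rule only has to be tested on pairs of
  basis vectors, where the hypotheses on the entries of \<open>R\<close> are exactly what is needed; nothing about the
  values of the Ricci curvature enters.\<close>

lemma is_basis_sum_eq_0D:
  fixes c :: "'n::finite \<Rightarrow> real"
  assumes e: "is_basis e" and z: "(\<Sum>i\<in>UNIV. c i *\<^sub>R e i) = 0"
  shows "c i = 0"
proof -
  have inj: "inj e" and ind: "independent (range e)" using e by (auto simp: is_basis_def)
  \<comment> \<open>Independence speaks of the set \<open>range e\<close>, so coefficients indexed
    by \<open>'n\<close> are carried over along \<open>inv e\<close>.\<close>
  have "(\<Sum>v\<in>range e. c (inv e v) *\<^sub>R v) = 0"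
    using z inj by (simp add: sum.reindex)
  then have "c (inv e (e i)) = 0"
    using real_vector.independentD[OF ind, of "range e" "\<lambda>v. c (inv e v)" "e i"] by simp
  then show ?thesis using inj by simp
qed

lemma matrix_wrt_lincomb:
  fixes e :: "'n::finite \<Rightarrow> 'a::real_vector"
  assumes "is_basis e"
  shows "matrix_wrt e (\<lambda>w. a *\<^sub>R f w + b *\<^sub>R h w) = a *\<^sub>R matrix_wrt e f + b *\<^sub>R matrix_wrt e h"
  using assms unfolding is_basis_def
  by (simp add: matrix_wrt_def vec_eq_iff real_vector.representation_add
      real_vector.representation_scale)

lemma matrix_wrt_ident:
  assumes "is_basis e"
  shows "matrix_wrt e (\<lambda>x. x) = mat 1"
  using assms unfolding is_basis_def
  by (auto simp: matrix_wrt_def vec_eq_iff mat_def real_vector.representation_basis inj_def)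

text \<open>\<open>endo_trace\<close> is computed in an arbitrarily chosen basis; moving to the
  matrix in \<open>e\<close> turns the trace into a fixed linear function of the entries.\<close>

lemma endo_trace_lincomb:
  fixes e :: "'n::finite \<Rightarrow> 'a::real_vector" and f h :: "'a \<Rightarrow> 'a"
  assumes e: "is_basis e" and f: "linear f" and h: "linear h"
  shows "endo_trace (\<lambda>w. a *\<^sub>R f w + b *\<^sub>R h w) = a * endo_trace f + b * endo_trace h"
proof -
  have "linear (\<lambda>w. a *\<^sub>R f w + b *\<^sub>R h w)"
    using f h by (intro linear_compose_add linear_compose_scale_right)
  then show ?thesis
    unfolding endo_trace_eq[OF f e] endo_trace_eq[OF h e]
    by (subst endo_trace_eq[OF _ e])
      (simp_all add: matrix_wrt_lincomb[OF e] trace_def sum.distrib sum_distrib_left)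
qed

text \<open>One equation covers additivity (\<open>a = b = 1\<close>) and homogeneity
  (\<open>b = 0\<close>), so each linearity proof below is a single rewriting goal.\<close>

lemma linearI_lincomb:
  assumes "\<And>a b x y. f (a *\<^sub>R x + b *\<^sub>R y) = a *\<^sub>R f x + b *\<^sub>R f y"
  shows "linear f"
  by (rule linearI) (use assms[of 1 _ 1] assms[of _ _ 0] in auto)

lemma linear_lincomb:
  assumes "linear f"
  shows "f (a *\<^sub>R x + b *\<^sub>R y) = a *\<^sub>R f x + b *\<^sub>R f y"
  using assms by (simp add: linear_add linear_cmul)

text \<open>Both sides of the Leibniz rule are bilinear in the two vectors, so agreement on pairs
  from a spanning set suffices.\<close>

lemma lie_derivation_basisI:
  assumes br: "lie_bracket br" and e: "is_basis e" and d: "linear d"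
    and eq: "\<And>i j. d (br (e i) (e j)) = br (d (e i)) (e j) + br (e i) (d (e j))"
  shows "lie_derivation br d"
proof -
  have bil: "bilinear br" using br by (simp add: lie_bracket_def)
  have "bilinear (\<lambda>x y. d (br x y))" "bilinear (\<lambda>x y. br (d x) y + br x (d y))"
    using bil d unfolding bilinear_def linear_iff by (auto simp: scaleR_add_right)
  then have "d (br x y) = br (d x) y + br x (d y)" for x y
    by (rule bilinear_eq[where B = "range e" and C = "range e"])
      (use e eq in \<open>auto simp: is_basis_def\<close>)
  then show ?thesis using d by (simp add: lie_derivation_def)
qed

locale pseudo_riemannian_lie_algebra =
  fixes br :: "'a::real_vector \<Rightarrow> 'a \<Rightarrow> 'a"
    and g :: "'a \<Rightarrow> 'a \<Rightarrow> real"
    and e :: "'n::finite \<Rightarrow> 'a"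
  assumes bracket: "bilinear br"
    and metric: "pseudo_riemannian g"
    and basis: "is_basis e"
begin

lemma bilinear_metric: "bilinear g"
  using metric by (simp add: pseudo_riemannian_def)

lemma linear_metric: "linear (\<lambda>x. g x w)" "linear (g x)"
  using bilinear_metric by (simp_all add: bilinear_def)

lemma linear_bracket: "linear (\<lambda>x. br x w)" "linear (br x)"
  using bracket by (simp_all add: bilinear_def)

lemmas metric_lincomb =
  linear_metric(1)[THEN linear_lincomb] linear_metric(2)[THEN linear_lincomb]

lemmas bracket_lincomb =
  linear_bracket(1)[THEN linear_lincomb] linear_bracket(2)[THEN linear_lincomb]

lemma metric_eqI:
  assumes "\<And>w. g x w = g y w"
  shows "x = y"
proof -
  have "g (x - y) w = 0" for w
    using assms[of w] by (simp add: linear_diff[OF linear_metric(1)])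
  then have "x - y = 0" using metric unfolding pseudo_riemannian_def by blast
  then show ?thesis by simp
qed

text \<open>In coordinates, nondegeneracy says that the Gram map \<open>F\<close> is injective; in
  finite dimension it is then surjective, which gives existence. Uniqueness is
  \<open>metric_eqI\<close>.\<close>

lemma ex1_metric_dual:
  assumes \<phi>: "linear \<phi>"
  shows "\<exists>!x. \<forall>w. g x w = \<phi> w"
proof -
  define F where "F c = (\<chi> i. g (\<Sum>j\<in>UNIV. c $ j *\<^sub>R e j) (e i))" for c :: "real^'n"
  have lin: "linear F"
    by (rule linearI)
      (simp_all add: F_def vec_eq_iff scaleR_add_left sum.distrib sum_distrib_left
        linear_add[OF linear_metric(1)] linear_sum[OF linear_metric(1)]
        linear_cmul[OF linear_metric(1)] mult.assoc)
  \<comment> \<open>Used with the zero form for injectivity of \<open>F\<close>, and with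
    \<open>\<phi>\<close> once a preimage is found.\<close>
  have ext: "g x w = \<psi> w" if "linear \<psi>" "\<And>i. g x (e i) = \<psi> (e i)" for x w \<psi>
    using real_vector.linear_eq_on[of "g x" \<psi> w "range e"] that linear_metric basis
    by (auto simp: is_basis_def linear_def real_scaleR_def[abs_def])
  have "inj F"
    unfolding linear_injective_0[OF lin]
  proof (intro allI impI)
    fix c assume "F c = 0"
    then have "g (\<Sum>j\<in>UNIV. c $ j *\<^sub>R e j) (e i) = 0" for i
      by (simp add: F_def vec_eq_iff)
    then have "g (\<Sum>j\<in>UNIV. c $ j *\<^sub>R e j) w = 0" for w
      using ext[of "\<lambda>_. 0"] linear_zero by blast
    then have "(\<Sum>j\<in>UNIV. c $ j *\<^sub>R e j) = 0"
      using metric by (auto simp: pseudo_riemannian_def)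
    then show "c = 0"
      using is_basis_sum_eq_0D[OF basis] by (simp add: vec_eq_iff)
  qed
  then have "surj F"
    by (rule linear_injective_imp_surjective[OF lin _ refl])
  then obtain c where c: "F c = (\<chi> i. \<phi> (e i))" by (metis surjD)
  have "g (\<Sum>j\<in>UNIV. c $ j *\<^sub>R e j) w = \<phi> w" for w
    by (rule ext[OF \<phi>]) (use c in \<open>simp add: F_def vec_eq_iff\<close>)
  then show ?thesis using metric_eqI by metis
qed

text \<open>Half of the right-hand side is a linear form in \<open>w\<close>, so duality supplies
  the vector that the definite description asks for.\<close>

lemma levi_civita_metric:
  "2 * g (levi_civita br g u v) w = g (br u v) w + g (br w u) v + g (br w v) u"
proof -
  define \<phi> where "\<phi> w = (g (br u v) w + g (br w u) v + g (br w v) u) / 2" for w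
  have "linear \<phi>"
    by (rule linearI_lincomb) (simp add: \<phi>_def metric_lincomb bracket_lincomb field_simps)
  from ex1_metric_dual[OF this]
  have "\<exists>!x. \<forall>w. 2 * g x w = g (br u v) w + g (br w u) v + g (br w v) u"
    by (simp add: \<phi>_def field_simps)
  from theI'[OF this] show ?thesis
    unfolding levi_civita_def by blast
qed

lemma linear_levi_civita:
  "linear (\<lambda>u. levi_civita br g u v)" "linear (levi_civita br g u)"
proof -
  \<comment> \<open>The factor 2 stays in the goal so that, once moved past the scalar coefficients,
    it meets the left side of \<open>levi_civita_metric\<close>.\<close>
  have eqI: "x = y" if "\<And>w. 2 * g x w = 2 * g y w" for x y
    using that by (intro metric_eqI) simp
  show "linear (\<lambda>u. levi_civita br g u v)" "linear (levi_civita br g u)"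
    by (intro linearI_lincomb eqI,
      simp add: metric_lincomb mult.left_commute[of 2] levi_civita_metric
        bracket_lincomb algebra_simps)+
qed

lemmas levi_civita_lincomb =
  linear_levi_civita(1)[THEN linear_lincomb] linear_levi_civita(2)[THEN linear_lincomb]

text \<open>The Ricci trace runs over the second argument; the first and third arguments become
  those of the Ricci form.\<close>

lemma curvature_lincomb:
  "curvature br g (a *\<^sub>R u + b *\<^sub>R u') v w = a *\<^sub>R curvature br g u v w + b *\<^sub>R curvature br g u' v w"
  "curvature br g u (a *\<^sub>R v + b *\<^sub>R v') w = a *\<^sub>R curvature br g u v w + b *\<^sub>R curvature br g u v' w"
  "curvature br g u v (a *\<^sub>R w + b *\<^sub>R w') = a *\<^sub>R curvature br g u v w + b *\<^sub>R curvature br g u v w'"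
  by (simp_all add: curvature_def levi_civita_lincomb bracket_lincomb algebra_simps)

lemma linear_ricci: "linear (\<lambda>u. ricci br g u v)" "linear (ricci br g u)"
proof -
  have "linear (\<lambda>w. curvature br g u w v)" for u v
    by (rule linearI_lincomb) (rule curvature_lincomb)
  note lincomb = endo_trace_lincomb[OF basis this this]
  show "linear (\<lambda>u. ricci br g u v)" "linear (ricci br g u)"
    by (rule linearI_lincomb, simp add: ricci_def curvature_lincomb lincomb)+
qed

text \<open>Linearity of the Ricci form in its second argument makes the operator well defined;
  linearity in the first then makes the operator linear.\<close>

lemma ricci_operator_metric: "g (ricci_operator br g u) v = ricci br g u v"
  using theI'[OF ex1_metric_dual[OF linear_ricci(2)], of u]
  by (simp add: ricci_operator_def)

lemma linear_ricci_operator: "linear (ricci_operator br g)"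
  by (intro linearI_lincomb metric_eqI)
    (simp add: metric_lincomb ricci_operator_metric linear_lincomb[OF linear_ricci(1)])

end

text \<open>The image of \<open>d\<close> lies in the Heisenberg ideal spanned by
  \<open>e 1\<close>, \<open>e 2\<close>, \<open>e 3\<close>. The bracket of \<open>e 2\<close> and
  \<open>e 3\<close> accounts for the eigenvalue \<open>p + q\<close> on the centre of that ideal.
  The brackets with \<open>e 4\<close> match the last column to \<open>a\<close> and
  \<open>b\<close>, and compare \<open>r\<close> with \<open>\<alpha> * r\<close> and
  \<open>s\<close> with \<open>\<alpha> * s\<close>.\<close>

lemma lie_algebra_4_8_derivationI:
  fixes e :: "4 \<Rightarrow> 'a::real_vector"
  assumes algebra: "lie_algebra_4_8 \<alpha> br e" and d: "linear d"
    and d1: "d (e 1) = (p + q) *\<^sub>R e 1"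
    and d2: "d (e 2) = a *\<^sub>R e 1 + p *\<^sub>R e 2 + r *\<^sub>R e 3"
    and d3: "d (e 3) = b *\<^sub>R e 1 + s *\<^sub>R e 2 + q *\<^sub>R e 3"
    and d4: "d (e 4) = c *\<^sub>R e 1 + b *\<^sub>R e 2 - (\<alpha> * a) *\<^sub>R e 3"
    and rs: "\<alpha> * r = r" "\<alpha> * s = s"
  shows "lie_derivation br d"
proof -
  have br: "lie_bracket br" and e: "is_basis e"
    and b14: "br (e 1) (e 4) = (1 + \<alpha>) *\<^sub>R e 1" and b24: "br (e 2) (e 4) = e 2"
    and b34: "br (e 3) (e 4) = \<alpha> *\<^sub>R e 3" and b23: "br (e 2) (e 3) = e 1"
    and b12: "br (e 1) (e 2) = 0" and b13: "br (e 1) (e 3) = 0"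
    using algebra by (auto simp: lie_algebra_4_8_def)
  have bil: "bilinear br" and alt: "br x x = 0" for x
    using br by (auto simp: lie_bracket_def)
  note lin = bilinear_ladd[OF bil] bilinear_radd[OF bil] bilinear_lmul[OF bil]
    bilinear_rmul[OF bil] bilinear_lsub[OF bil] bilinear_rsub[OF bil]
  have skew: "br y x = - br x y" for x y
    using alt[of "x + y"] alt[of x] alt[of y] by (simp add: lin eq_neg_iff_add_eq_0)
  note b = b14 b24 b34 b23 b12 b13
  \<comment> \<open>The reversed brackets, so that all sixteen ordered pairs of basis vectors can be
    rewritten.\<close>
  note b' = b[THEN trans[OF skew arg_cong[where f = uminus]]]
  note dlin = linear_add[OF d] linear_diff[OF d] linear_cmul[OF d] linear_neg[OF d] linear_0[OF d]
  have "\<forall>i j. d (br (e i) (e j)) = br (d (e i)) (e j) + br (e i) (d (e j))"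
    unfolding forall_4
    by (simp add: b b' alt dlin d1 d2 d3 d4 lin rs algebra_simps)
  then show ?thesis
    by (intro lie_derivation_basisI[OF br e d]) blast
qed

theorem theorem4p9:
  fixes \<alpha> :: real
    and br :: "'a::real_vector \<Rightarrow> 'a \<Rightarrow> 'a"
    and e :: "4 \<Rightarrow> 'a"
    and g :: "'a \<Rightarrow> 'a \<Rightarrow> real"
    and R D :: "real^4^4"
    and \<eta> :: real
  assumes alpha: "-1 < \<alpha>" "\<alpha> \<le> 1"
    and algebra: "lie_algebra_4_8 \<alpha> br e"
    and metric: "pseudo_riemannian g"
    and R_def: "R = matrix_wrt e (ricci_operator br g)"
    and eta_def: "\<eta> = R$4$4"
    and D_def: "D = vector
      [vector [R$1$1 - R$4$4, R$1$2,         R$1$3,         R$1$4],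
       vector [0,             R$2$2 - R$4$4, R$2$3,         R$1$3],
       vector [0,             R$3$2,         R$3$3 - R$4$4, - \<alpha> * R$1$2],
       vector [0,             0,             0,             0]]"
  shows "(R$2$1 = 0 \<and> R$3$1 = 0 \<and> R$4$1 = 0 \<and>
          R$4$2 = 0 \<and> R$4$3 = 0 \<and>
          R$3$4 = - \<alpha> * R$1$2 \<and> R$2$4 = R$1$3 \<and>
          \<alpha> * R$3$2 = R$3$2 \<and> \<alpha> * R$2$3 = R$2$3 \<and>
          R$4$4 = R$2$2 + R$3$3 - R$1$1
          \<longrightarrow> algebraic_ricci_soliton br g \<and>
              \<eta> = R$2$2 + R$3$3 - R$1$1 \<and>
              R = mat \<eta> + D \<and>
              (\<exists>d. lie_derivation br d \<and> matrix_wrt e d = D \<and>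
                   ricci_operator br g = (\<lambda>x. \<eta> *\<^sub>R x + d x))) \<and>
         (R$2$3 = 0 \<and> R$3$2 = 0
          \<longrightarrow> (\<forall>a::real. a * R$3$2 = R$3$2 \<and> a * R$2$3 = R$2$3)) \<and>
         (\<alpha> * R$3$2 = R$3$2 \<and> \<alpha> * R$2$3 = R$2$3 \<and> (R$2$3 \<noteq> 0 \<or> R$3$2 \<noteq> 0)
          \<longrightarrow> \<alpha> = 1)"
proof -
  have e: "is_basis e" and br: "bilinear br"
    using algebra by (auto simp: lie_algebra_4_8_def lie_bracket_def)
  interpret pseudo_riemannian_lie_algebra br g e
    using br metric e by unfold_locales
  let ?Ric = "ricci_operator br g"
  define d where "d x = ?Ric x - \<eta> *\<^sub>R x" for x
  have lin: "linear d"
    unfolding d_def by (intro linear_compose_sub linear_ricci_operator linear_scale_self)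
  have Ric_e: "?Ric (e j) = R$1$j *\<^sub>R e 1 + R$2$j *\<^sub>R e 2 + R$3$j *\<^sub>R e 3 + R$4$j *\<^sub>R e 4" for j
    using matrix_wrt_column[OF e, of ?Ric j] by (simp add: R_def sum_4)
  have Ric: "?Ric = (\<lambda>x. \<eta> *\<^sub>R x + d x)"
    by (simp add: d_def)
  have mat_d: "matrix_wrt e d = R - mat \<eta>"
    using matrix_wrt_lincomb[OF e, of 1 ?Ric "- \<eta>" "\<lambda>x. x"]
    by (simp add: d_def[abs_def] matrix_wrt_ident[OF e] R_def vec_eq_iff mat_def)
  show ?thesis
  proof (intro conjI impI; (elim conjE)?)
    assume col: "R$2$1 = 0" "R$3$1 = 0" "R$4$1 = 0" "R$4$2 = 0" "R$4$3 = 0"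
      and R34: "R$3$4 = - \<alpha> * R$1$2" and R24: "R$2$4 = R$1$3"
      and rs: "\<alpha> * R$3$2 = R$3$2" "\<alpha> * R$2$3 = R$2$3"
      and R44: "R$4$4 = R$2$2 + R$3$3 - R$1$1"
    have der: "lie_derivation br d"
    proof (rule lie_algebra_4_8_derivationI[OF algebra lin _ _ _ _ rs])
      \<comment> \<open>The eigenvalue \<open>R$1$1 - \<eta>\<close> takes the form
        \<open>p + q\<close> because \<open>\<eta> = R$4$4 = R$2$2 + R$3$3 - R$1$1\<close>. The same
        \<open>\<eta>\<close> cancels the \<open>e 4\<close> component of
        \<open>d (e 4)\<close>.\<close>
      show "d (e 1) = ((R$2$2 - \<eta>) + (R$3$3 - \<eta>)) *\<^sub>R e 1"
        "d (e 2) = R$1$2 *\<^sub>R e 1 + (R$2$2 - \<eta>) *\<^sub>R e 2 + R$3$2 *\<^sub>R e 3"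
        "d (e 3) = R$1$3 *\<^sub>R e 1 + R$2$3 *\<^sub>R e 2 + (R$3$3 - \<eta>) *\<^sub>R e 3"
        "d (e 4) = R$1$4 *\<^sub>R e 1 + R$1$3 *\<^sub>R e 2 - (\<alpha> * R$1$2) *\<^sub>R e 3"
        by (simp_all add: d_def Ric_e eta_def col R34 R24 R44 algebra_simps flip: scaleR_2)
    qed
    show "algebraic_ricci_soliton br g"
      unfolding algebraic_ricci_soliton_def using der Ric by blast
    show "\<eta> = R$2$2 + R$3$3 - R$1$1"
      using eta_def R44 by simp
    show RD: "R = mat \<eta> + D"
      by (simp add: D_def vec_eq_iff forall_4 mat_def eta_def col R34 R24)
    show "\<exists>d. lie_derivation br d \<and> matrix_wrt e d = D \<and> ?Ric = (\<lambda>x. \<eta> *\<^sub>R x + d x)"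
      using der Ric mat_d RD by (metis add_diff_cancel_left')
  \<comment> \<open>Left are the two claims on \<open>\<alpha>\<close>: zero entries satisfy both
    identities for every scalar, and a nonzero entry can be cancelled.\<close>
  qed auto
qed

end
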